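(* For all $\phi,\psi\in\mathcal{L}$: if $\vdash\phi\le\psi$ then $\models\phi\le\psi$.
   Context: A quasi-applicative transition system (quasi-ats) is $(A,ev)$ with $ev:A\rightharpoonup(A\to A)$ partial; write $a\Downarrow f$ if $ev(a)=f$. The domain logic $\mathcal{L}$ has syntax $\phi::=t\mid\phi\wedge\psi\mid(\phi\to\psi)_\bot$ ($t$ = true). Satisfaction in a quasi-ats: $a\models t$ always; $a\models\phi\wedge\psi$ iff $a\models\phi$ and $a\models\psi$; $a\models(\phi\to\psi)_\bot$ iff $a\Downarrow f$ and for all $b\in A$, $b\models\phi$ implies $f(b)\models\psi$. $\models\phi\le\psi$ means that in every quasi-ats every element satisfying $\phi$ satisfies $\psi$. The proof system $\vdash$: reflexivity and transitivity of $\le$; $\phi=\psi$ iff $\phi\le\psi$ and $\psi\le\phi$; $\phi\le t$; $\wedge$-introduction and elimination; if $\phi_2\le\phi_1$ and $\psi_1\le\psi_2$ then $(\phi_1\to\psi_1)_\bot\le(\phi_2\to\psi_2)_\bot$; $(\phi\to\psi_1\wedge\psi_2)_\bot=(\phi\to\psi_1)_\bot\wedge(\phi\to\psi_2)_\bot$; $(\phi\to t)_\bot\le(t\to t)_\bot$. *)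

theory Defs
  imports Main "HOL-Library.FuncSet"
begin

datatype form =
    Tt
  | Conj form form  (infixr "\<^bold>\<and>" 70)
  | Arr form form

text \<open>
  A quasi-applicative transition system is an arbitrary (possibly empty) carrier set \<open>A\<close> with a
  partial map \<open>ev\<close> from \<open>A\<close> to functions from \<open>A\<close> to \<open>A\<close>; \<open>ev a = Some f\<close> renders convergence of
  \<open>a\<close> to \<open>f\<close>. The values of \<open>ev\<close> and of the functions \<open>f\<close> outside \<open>A\<close> are irrelevant: all
  quantifiers over elements below are restricted to \<open>A\<close>.
\<close>

definition quasi_ats :: "'a set \<Rightarrow> ('a \<Rightarrow> ('a \<Rightarrow> 'a) option) \<Rightarrow> bool" where
  "quasi_ats A ev \<longleftrightarrow> (\<forall>a\<in>A. \<forall>f. ev a = Some f \<longrightarrow> f \<in> A \<rightarrow> A)"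

primrec sat :: "'a set \<Rightarrow> ('a \<Rightarrow> ('a \<Rightarrow> 'a) option) \<Rightarrow> 'a \<Rightarrow> form \<Rightarrow> bool" where
  "sat A ev a Tt \<longleftrightarrow> True"
| "sat A ev a (\<phi> \<^bold>\<and> \<psi>) \<longleftrightarrow> sat A ev a \<phi> \<and> sat A ev a \<psi>"
| "sat A ev a (Arr \<phi> \<psi>) \<longleftrightarrow>
     (\<exists>f. ev a = Some f \<and> (\<forall>b\<in>A. sat A ev b \<phi> \<longrightarrow> sat A ev (f b) \<psi>))"

text \<open>
  HOL cannot quantify over types inside a formula, so validity is indexed by the type in which the
  carriers live; validity in every quasi-ats is \<open>valid_le TYPE('a) \<phi> \<psi>\<close> for every type \<open>'a\<close>.
\<close>

definition valid_le :: "'a itself \<Rightarrow> form \<Rightarrow> form \<Rightarrow> bool" where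
  "valid_le _ \<phi> \<psi> \<longleftrightarrow>
     (\<forall>(A :: 'a set) ev. quasi_ats A ev \<longrightarrow> (\<forall>a\<in>A. sat A ev a \<phi> \<longrightarrow> sat A ev a \<psi>))"

inductive deriv_le :: "form \<Rightarrow> form \<Rightarrow> bool"  ("\<turnstile> _ \<preceq> _" [61, 61] 60)
  and deriv_eq :: "form \<Rightarrow> form \<Rightarrow> bool"  ("\<turnstile> _ \<simeq> _" [61, 61] 60)
where
  le_refl: "\<turnstile> \<phi> \<preceq> \<phi>"
| le_trans: "\<lbrakk>\<turnstile> \<phi> \<preceq> \<psi>; \<turnstile> \<psi> \<preceq> \<chi>\<rbrakk> \<Longrightarrow> \<turnstile> \<phi> \<preceq> \<chi>"
| eq_intro: "\<lbrakk>\<turnstile> \<phi> \<preceq> \<psi>; \<turnstile> \<psi> \<preceq> \<phi>\<rbrakk> \<Longrightarrow> \<turnstile> \<phi> \<simeq> \<psi>"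
| eq_elim1: "\<turnstile> \<phi> \<simeq> \<psi> \<Longrightarrow> \<turnstile> \<phi> \<preceq> \<psi>"
| eq_elim2: "\<turnstile> \<phi> \<simeq> \<psi> \<Longrightarrow> \<turnstile> \<psi> \<preceq> \<phi>"
| le_Tt: "\<turnstile> \<phi> \<preceq> Tt"
| conj_intro: "\<lbrakk>\<turnstile> \<phi> \<preceq> \<psi>\<^sub>1; \<turnstile> \<phi> \<preceq> \<psi>\<^sub>2\<rbrakk> \<Longrightarrow> \<turnstile> \<phi> \<preceq> \<psi>\<^sub>1 \<^bold>\<and> \<psi>\<^sub>2"
| conj_elim1: "\<turnstile> \<phi> \<^bold>\<and> \<psi> \<preceq> \<phi>"
| conj_elim2: "\<turnstile> \<phi> \<^bold>\<and> \<psi> \<preceq> \<psi>"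
| arr_mono: "\<lbrakk>\<turnstile> \<phi>\<^sub>2 \<preceq> \<phi>\<^sub>1; \<turnstile> \<psi>\<^sub>1 \<preceq> \<psi>\<^sub>2\<rbrakk> \<Longrightarrow> \<turnstile> Arr \<phi>\<^sub>1 \<psi>\<^sub>1 \<preceq> Arr \<phi>\<^sub>2 \<psi>\<^sub>2"
| arr_conj: "\<turnstile> Arr \<phi> (\<psi>\<^sub>1 \<^bold>\<and> \<psi>\<^sub>2) \<simeq> Arr \<phi> \<psi>\<^sub>1 \<^bold>\<and> Arr \<phi> \<psi>\<^sub>2"
| arr_Tt: "\<turnstile> Arr \<phi> Tt \<preceq> Arr Tt Tt"

end

theory Submission imports Defs begin

text \<open>Rule induction on derivations: each rule preserves validity over carriers in the fixed
  type \<open>'a\<close>. Only monotonicity of \<open>Arr\<close> (\<open>valid_le_Arr_mono\<close>)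
  needs closure of the carrier under application; the other rules follow by unfolding
  satisfaction.\<close>

lemma valid_le_Arr_mono:
  assumes "valid_le TYPE('a) \<phi>\<^sub>2 \<phi>\<^sub>1" and "valid_le TYPE('a) \<psi>\<^sub>1 \<psi>\<^sub>2"
  shows "valid_le TYPE('a) (Arr \<phi>\<^sub>1 \<psi>\<^sub>1) (Arr \<phi>\<^sub>2 \<psi>\<^sub>2)"
  unfolding valid_le_def
proof (intro allI impI ballI)
  fix A :: "'a set" and ev a
  assume ats: "quasi_ats A ev" and a: "a \<in> A" and "sat A ev a (Arr \<phi>\<^sub>1 \<psi>\<^sub>1)"
  then obtain f where f: "ev a = Some f" and sat: "\<And>b. b \<in> A \<Longrightarrow> sat A ev b \<phi>\<^sub>1 \<Longrightarrow> sat A ev (f b) \<psi>\<^sub>1"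
    by auto
  \<comment> \<open>Validity speaks only of carrier elements, so \<open>f b\<close> must lie in
    \<open>A\<close> before the inequality between the codomain formulas applies to it.\<close>
  have "f \<in> A \<rightarrow> A"
    using ats a f by (simp add: quasi_ats_def)
  then have "sat A ev (f b) \<psi>\<^sub>2" if "b \<in> A" "sat A ev b \<phi>\<^sub>2" for b
    using assms ats sat that unfolding valid_le_def by blast
  then show "sat A ev a (Arr \<phi>\<^sub>2 \<psi>\<^sub>2)"
    using f by simp
qed

text \<open>The two judgements are derived by mutual induction, so both are treated at once; reading
  equality as validity in both directions makes its introduction and elimination rules
  immediate.\<close>

lemma deriv_sound:
  shows "\<turnstile> \<phi> \<preceq> \<psi> \<Longrightarrow> valid_le TYPE('a) \<phi> \<psi>"
    and "\<turnstile> \<phi> \<simeq> \<psi> \<Longrightarrow> valid_le TYPE('a) \<phi> \<psi> \<and> valid_le TYPE('a) \<psi> \<phi>"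
proof (induction rule: deriv_le_deriv_eq.inducts)
  case (arr_mono \<phi>\<^sub>2 \<phi>\<^sub>1 \<psi>\<^sub>1 \<psi>\<^sub>2)
  then show ?case
    by (simp add: valid_le_Arr_mono)
\<comment> \<open>For \<open>arr_conj\<close>, the functions witnessing the two conjuncts coincide
  because \<open>ev\<close> is single-valued; for \<open>arr_Tt\<close>, both sides just say that
  \<open>a\<close> converges.\<close>
qed (auto simp: valid_le_def)

theorem mainTheorem16:
  fixes \<phi> \<psi> :: form
  assumes "\<turnstile> \<phi> \<preceq> \<psi>"
  shows "valid_le TYPE('a) \<phi> \<psi>"
  using assms by (rule deriv_sound)

end
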